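(* Let $n$ be a natural number, and let $L'_n := \{d : d \mid n,\ \sqrt{n} \le d \le n\}$ be the set of positive divisors of $n$ that are at least $\sqrt{n}$. If the numbers in $L'_n$ are in arithmetic progression, then one of the following is true: (i) $n = 1$, hence $L'_n = \{1\}$. (ii) $n = p$ for some prime $p$, hence $L'_n = \{p\}$. (iii) $n = p^2$ for some prime $p$, hence $L'_n = \{p, p^2\}$. (iv) $n = p^3$ for some prime $p$, hence $L'_n = \{p^2, p^3\}$. (v) $n = pq$ for some primes $p<q$, hence $L'_n=\{q, pq\}$.
   Context: Natural numbers are positive integers. The numbers in a finite set $S$ of natural numbers are said to be in arithmetic progression (or $S$ forms an arithmetic progression) if $S = \{d, d+a, d+2a, \ldots, d+(k-1)a\}$ for some natural numbers $d, a, k$; the empty set is regarded as vacuously forming an arithmetic progression. (In particular, every set with one or two elements forms an arithmetic progression.) *)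

theory Defs
  imports Complex_Main "HOL-Computational_Algebra.Primes"
begin

text \<open>
  The first term \<open>d\<close>, the common difference \<open>a\<close> and the length \<open>k\<close> are positive integers;
  the empty set counts as an arithmetic progression by convention.
\<close>

definition arith_progression :: "nat set \<Rightarrow> bool" where
  "arith_progression S \<longleftrightarrow>
     S = {} \<or> (\<exists>d a k. d > 0 \<and> a > 0 \<and> k > 0 \<and> S = {d + i * a | i. i < k})"

definition large_divisors :: "nat \<Rightarrow> nat set" where
  "large_divisors n = {d. d > 0 \<and> d dvd n \<and> sqrt (real n) \<le> real d \<and> d \<le> n}"

end

theory Submission
  imports Defs
begin

text \<open>
  The greatest element of \<open>L = large_divisors n\<close> is \<open>n\<close> itself, and every other divisor of \<open>n\<close>
  is at most \<open>n / 2\<close>. Hence a progression with three terms does not fit: if its difference is \<open>a\<close>,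
  then its second largest term \<open>n - a\<close> is at most \<open>n / 2\<close>, so \<open>n - 2 * a \<le> 0\<close>, whereas the third
  largest term is positive. So \<open>L\<close> has at most two elements (\<open>card_large_divisors_le_2\<close>).

  The map \<open>d \<mapsto> n / d\<close> turns \<open>L\<close> into the set of divisors \<open>d\<close> with \<open>d\<^sup>2 \<le> n\<close>
  (\<open>large_divisors_eq_image\<close>). There are thus at most two of these, one of which is \<open>1\<close>. If it is
  the only one, then \<open>n\<close> is \<open>1\<close> or prime. Otherwise the other one is a prime \<open>p\<close>, and the
  requirement that no further divisor is at most the square root leaves just \<open>p\<^sup>2\<close>, \<open>p\<^sup>3\<close> and
  \<open>p * q\<close> with a prime \<open>q > p\<close> (\<open>cofactor_of_unique_small_divisor\<close>).
\<close>

definition small_divisors :: "nat \<Rightarrow> nat set" where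
  "small_divisors n = {d. d dvd n \<and> d * d \<le> n}"

lemma one_in_small_divisors: "n > 0 \<Longrightarrow> 1 \<in> small_divisors n"
  by (auto simp: small_divisors_def)

lemma small_factor_in_small_divisors:
  fixes a b n :: nat
  assumes "n = a * b" "a \<le> b"
  shows "a \<in> small_divisors n"
  using assms by (auto simp: small_divisors_def)

lemma large_divisors_eq_image:
  assumes "n > 0"
  shows "large_divisors n = (\<lambda>d. n div d) ` small_divisors n"
proof -
  have sqrt_le_iff: "sqrt (real n) \<le> real x \<longleftrightarrow> n \<le> x * x" for x
  proof -
    have "sqrt (real n) \<le> real x \<longleftrightarrow> sqrt (real n) \<le> sqrt (real (x * x))" by simp
    also have "\<dots> \<longleftrightarrow> n \<le> x * x" by (simp only: real_sqrt_le_iff of_nat_le_iff)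
    finally show ?thesis .
  qed
  show ?thesis
  proof (intro equalityI subsetI)
    fix x assume "x \<in> large_divisors n"
    then obtain d where d: "n = x * d" and "n \<le> x * x" "x > 0"
      by (auto simp: large_divisors_def sqrt_le_iff elim!: dvdE)
    then have "d \<le> x" by simp
    then have "d \<in> small_divisors n" and "x = n div d"
      using d assms by (auto simp: small_divisors_def)
    then show "x \<in> (\<lambda>d. n div d) ` small_divisors n" by blast
  next
    fix x assume "x \<in> (\<lambda>d. n div d) ` small_divisors n"
    then obtain d where "d dvd n" "d * d \<le> n" and x: "x = n div d"
      by (auto simp: small_divisors_def)
    then have n: "n = d * x" by simp
    then have "d > 0" "x > 0" using assms by auto
    moreover have "d \<le> x" using \<open>d * d \<le> n\<close> n \<open>d > 0\<close> by simp
    moreover from \<open>d \<le> x\<close> have "n \<le> x * x" unfolding n by (rule mult_le_mono1)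
    then have "sqrt (real n) \<le> real x" by (simp only: sqrt_le_iff)
    moreover have "x dvd n" unfolding n by (rule dvd_triv_right)
    ultimately show "x \<in> large_divisors n"
      using assms by (simp add: large_divisors_def dvd_imp_le)
  qed
qed

text \<open>
  If \<open>n = d + i * a\<close> is the greatest term and \<open>i \<ge> 2\<close>, the term before it is a proper divisor of
  \<open>n\<close>, so that passing to it at least halves \<open>n\<close>; the same step once more would reach \<open>0\<close> or below.
\<close>

lemma card_large_divisors_le_2:
  assumes "n > 0" "arith_progression (large_divisors n)"
  shows "card (large_divisors n) \<le> 2"
proof -
  have n_in: "n \<in> large_divisors n"
    using one_in_small_divisors[OF assms(1)] large_divisors_eq_image[OF assms(1)] by force
  then obtain d a k where d: "d > 0" "a > 0" "k > 0"
    and L: "large_divisors n = {d + i * a | i. i < k}"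
    using assms(2) by (auto simp: arith_progression_def)
  have term_in: "d + i * a \<in> large_divisors n" if "i < k" for i
    using L that by blast
  have "k \<le> 2"
  proof (rule ccontr)
    assume "\<not> k \<le> 2"
    then have "k = Suc (Suc (Suc (k - 3)))" by simp
    then obtain j where k: "k = Suc (Suc (Suc j))" ..
    obtain i where i: "n = d + i * a" "i < k" using n_in L by blast
    have "d + Suc (Suc j) * a \<le> n"
      using term_in[of "Suc (Suc j)"] k by (simp add: large_divisors_def)
    moreover have "i * a \<le> Suc (Suc j) * a" using i(2) k by (intro mult_le_mono1) simp
    ultimately have n: "n = d + Suc j * a + a" using i(1) by simp
    have "d + Suc j * a dvd n"
      using term_in[of "Suc j"] k by (simp add: large_divisors_def)
    then have "d + Suc j * a dvd a" unfolding n by (simp add: dvd_add_right_iff)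
    then have "d + Suc j * a \<le> a" using \<open>a > 0\<close> by (rule dvd_imp_le)
    then show False using \<open>d > 0\<close> by simp
  qed
  moreover have "large_divisors n = (\<lambda>i. d + i * a) ` {..<k}" using L by auto
  ultimately show ?thesis
    using card_image_le[of "{..<k}" "\<lambda>i. d + i * a"] by simp
qed

lemma small_divisors_unique:
  assumes "n > 0" "arith_progression (large_divisors n)"
    and "d \<in> small_divisors n" "e \<in> small_divisors n" "d > 1" "e > 1"
  shows "d = e"
proof (rule ccontr)
  assume "d \<noteq> e"
  have "small_divisors n \<subseteq> {..n}"
    using assms(1) by (auto simp: small_divisors_def dvd_imp_le)
  then have "finite (small_divisors n)" by (rule finite_subset) simp
  have "inj_on (\<lambda>d. n div d) (small_divisors n)"
  proof (rule inj_onI)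
    fix x y assume xy: "x \<in> small_divisors n" "y \<in> small_divisors n" and eq: "n div x = n div y"
    from xy have "x * (n div x) = n" "y * (n div y) = n" by (simp_all add: small_divisors_def)
    then have "x * (n div x) = n" "y * (n div x) = n" using eq by simp_all
    then show "x = y" using assms(1) by (metis mult_right_cancel mult_0_right less_irrefl)
  qed
  then have "card (small_divisors n) = card (large_divisors n)"
    using assms(1) by (simp add: large_divisors_eq_image card_image)
  also have "\<dots> \<le> 2" using assms(1,2) by (rule card_large_divisors_le_2)
  finally have "card (small_divisors n) \<le> 2" .
  moreover have "card {1, d, e} \<le> card (small_divisors n)"
    using assms one_in_small_divisors \<open>finite (small_divisors n)\<close> by (intro card_mono) auto
  ultimately show False using assms(5,6) \<open>d \<noteq> e\<close> by simp
qed

lemma one_or_prime_if_small_divisors_trivial: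
  assumes "n > 0" "small_divisors n = {1}"
  shows "n = 1 \<or> prime n"
proof (rule ccontr)
  assume "\<not> (n = 1 \<or> prime n)"
  then obtain a where "a dvd n" "a \<noteq> 1" "a \<noteq> n"
    using assms(1) by (auto simp: prime_nat_iff)
  then obtain b where n: "n = a * b" "a \<noteq> 1" "b \<noteq> 1" by (auto elim!: dvdE)
  show False
  proof (cases "a \<le> b")
    case True
    then show False using small_factor_in_small_divisors[of n a b] assms n by auto
  next
    case False
    then show False using small_factor_in_small_divisors[of n b a] assms n by auto
  qed
qed

lemma prime_if_unique_small_divisor:
  assumes "small_divisors n = {1, p}" "p > 1"
  shows "prime p"
  unfolding prime_nat_iff
proof (intro conjI allI impI)
  fix a assume "a dvd p"
  have "p \<in> small_divisors n" using assms(1) by simp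
  then have p: "p dvd n" "p * p \<le> n" by (simp_all add: small_divisors_def)
  have "a \<le> p" using \<open>a dvd p\<close> assms(2) by (simp add: dvd_imp_le)
  then have "a * a \<le> n" using p(2) mult_le_mono[of a p a p] by linarith
  then have "a \<in> small_divisors n"
    using \<open>a dvd p\<close> p(1) by (auto simp: small_divisors_def intro: dvd_trans)
  then show "a = 1 \<or> a = p" using assms(1) by simp
qed (use assms in auto)

text \<open>
  If the cofactor \<open>m\<close> is composite, its smaller factor is at most the square root of \<open>n\<close> and so
  is \<open>p\<close>; that is, \<open>n = p\<^sup>2 * b\<close> with \<open>b \<ge> p\<close>. One of \<open>p\<^sup>2\<close> and \<open>b\<close> is again at most the
  square root, hence \<open>1\<close> or \<open>p\<close>. It cannot be \<open>p\<^sup>2\<close>, so it is \<open>b\<close>, and \<open>b = p\<close>.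
\<close>

lemma cofactor_of_unique_small_divisor:
  assumes small: "small_divisors (p * m) = {1, p}" and "p > 1"
  shows "prime m \<or> m = p ^ 2"
proof (rule ccontr)
  assume contra: "\<not> (prime m \<or> m = p ^ 2)"
  have "p \<in> small_divisors (p * m)" using small by simp
  then have "p * p \<le> p * m" by (simp add: small_divisors_def)
  then have "p \<le> m" using \<open>p > 1\<close> by simp
  then have "m > 1" using \<open>p > 1\<close> by simp
  then have "small_divisors m \<noteq> {1}"
    using one_or_prime_if_small_divisors_trivial[of m] contra by auto
  then obtain a where a: "a \<in> small_divisors m" "a \<noteq> 1"
    using one_in_small_divisors[of m] \<open>m > 1\<close> by auto
  have "a dvd m" "a * a \<le> m" using a(1) by (simp_all add: small_divisors_def)
  moreover have "m \<le> p * m" using \<open>p > 1\<close> by simp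
  ultimately have "a \<in> small_divisors (p * m)"
    unfolding small_divisors_def by (blast intro: dvd_mult order_trans)
  then have "a = p" using a(2) small by auto
  then have "p dvd m" "p * p \<le> m" using a(1) by (simp_all add: small_divisors_def)
  then obtain b where m: "m = p * b" by blast
  then have "b > 1" using \<open>p * p \<le> m\<close> \<open>p > 1\<close> by simp
  have n: "p * m = (p * p) * b" "p * m = b * (p * p)" using m by simp_all
  show False
  proof (cases "b \<le> p * p")
    case True
    then have "b \<in> small_divisors (p * m)"
      by (rule small_factor_in_small_divisors[OF n(2)])
    then have "b = p" using small \<open>b > 1\<close> by auto
    then show False using contra m by (simp add: power2_eq_square)
  next
    case False
    then have "p * p \<in> small_divisors (p * m)"
      by (intro small_factor_in_small_divisors[OF n(1)]) simp
    then show False using small \<open>p > 1\<close> by auto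
  qed
qed

theorem corollary1p2:
  fixes n :: nat
  assumes "n > 0"
    and "arith_progression (large_divisors n)"
  shows "(n = 1 \<and> large_divisors n = {1})
    \<or> (\<exists>p. prime p \<and> n = p \<and> large_divisors n = {p})
    \<or> (\<exists>p. prime p \<and> n = p ^ 2 \<and> large_divisors n = {p, p ^ 2})
    \<or> (\<exists>p. prime p \<and> n = p ^ 3 \<and> large_divisors n = {p ^ 2, p ^ 3})
    \<or> (\<exists>p q. prime p \<and> prime q \<and> p < q \<and> n = p * q \<and> large_divisors n = {q, p * q})"
proof (cases "small_divisors n = {1}")
  case True
  then have "large_divisors n = {n}"
    using large_divisors_eq_image[OF assms(1)] by simp
  then show ?thesis
    using one_or_prime_if_small_divisors_trivial[OF assms(1) True] by auto
next
  case False
  then obtain p where p: "p \<in> small_divisors n" "p \<noteq> 1"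
    using one_in_small_divisors[OF assms(1)] by auto
  then have "p dvd n" "p * p \<le> n" by (simp_all add: small_divisors_def)
  then obtain m where n: "n = p * m" by blast
  then have "p > 1" "p \<le> m" using assms(1) p(2) \<open>p * p \<le> n\<close> by auto
  have "0 \<notin> small_divisors n" using assms(1) by (auto simp: small_divisors_def)
  then have "d = 1 \<or> d = p" if "d \<in> small_divisors n" for d
    using small_divisors_unique[OF assms that p(1)] that \<open>p > 1\<close>
    by (cases "d = 0"; cases "d = 1") auto
  then have small: "small_divisors n = {1, p}"
    using p(1) one_in_small_divisors[OF assms(1)] by blast
  have "prime p" using small \<open>p > 1\<close> by (rule prime_if_unique_small_divisor)
  have large: "large_divisors n = {m, p * m}"
    using large_divisors_eq_image[OF assms(1)] small n \<open>p > 1\<close> by auto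
  have "prime m \<or> m = p ^ 2"
    using cofactor_of_unique_small_divisor small n \<open>p > 1\<close> by simp
  then consider "m = p" | "m = p ^ 2" | "prime m" "p < m"
    using \<open>p \<le> m\<close> by linarith
  then show ?thesis
  proof cases
    case 1
    then have "n = p ^ 2" "large_divisors n = {p, p ^ 2}"
      using n large by (simp_all add: power2_eq_square)
    then show ?thesis using \<open>prime p\<close> by blast
  next
    case 2
    then have "n = p ^ 3" "large_divisors n = {p ^ 2, p ^ 3}"
      using n large by (simp_all add: power2_eq_square power3_eq_cube mult.assoc)
    then show ?thesis using \<open>prime p\<close> by blast
  next
    case 3
    then show ?thesis using \<open>prime p\<close> n large by blast
  qed
qed

end
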